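(* Let $m\ge 3$, let $X_1^0,\dots,X_m^0$ be a basic tuple with constants $r,R$, let $\lambda\ge 1+R/r$, $\varepsilon=1/\lambda$, and let $B^{(k)}$, $k\ge1$, be the generations of random variables (all as defined in the context). Let $f:[0,1]\to\mathbb R$ be piecewise continuous and let $K\in\mathbb R$. If $J_f(X_i^0)=K$ for all $1\le i\le m$, then for every $k\ge1$ and every $X\in B^{(k)}$, $$J_f(X)=K\varepsilon\,\frac{1-\varepsilon^k}{1-\varepsilon}.$$
   Context: Quantile function of a random variable $X$: $x(u)=\inf\{x:\mathbf P(X\le x)\ge u\}$, $u\in(0,1)$. For a random variable $X$ with quantile function $x$, $J_f(X)=\int_0^1 f(u)x(u)\,du$. For random variables, $X\prec Y$ means $\mathbf E\,\mathrm{sign}(Y-X)>0$. Basic tuple: independent random variables $X_1^0,\dots,X_m^0$, $m\ge3$, with quantile functions $x_1^0,\dots,x_m^0$, such that $X_1^0\prec X_2^0\prec\dots\prec X_m^0\prec X_1^0$ and $$\inf_{u_1,u_2\in(0,1)}\min_{i_1\ne i_2}|x^0_{i_1}(u_1)-x^0_{i_2}(u_2)|=r>0,\qquad \sup_{u_1,u_2\in(0,1)}\max_{i_1\ne i_2}|x^0_{i_1}(u_1)-x^0_{i_2}(u_2)|=R<\infty.$$ Generations: for $i_1\dots i_k\in\{1,\dots,m\}^k$ put $x_{i_1\dots i_k}(u)=\sum_{l=1}^k\varepsilon^l x^0_{i_l}(u)$. Let $U_{i_1\dots i_k}$ be independent random variables uniformly distributed on $[0,1]$, and $X_{i_1\dots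 i_k}=x_{i_1\dots i_k}(U_{i_1\dots i_k})$ (whose quantile function is $x_{i_1\dots i_k}$). Then $B^{(k)}=\{X_{i_1\dots i_k}: i_1\dots i_k\in\{1,\dots,m\}^k\}$. *)

theory Defs
  imports "HOL-Probability.Probability"
begin

text \<open>Only the values for \<open>0 < u < 1\<close> are meaningful; there the set is nonempty and bounded
  below whenever \<open>X\<close> is a real random variable on the probability space \<open>M\<close>.\<close>

definition quantile :: "'a measure \<Rightarrow> ('a \<Rightarrow> real) \<Rightarrow> real \<Rightarrow> real" where
  "quantile M X u = Inf {x. \<P>(\<omega> in M. X \<omega> \<le> x) \<ge> u}"

definition J :: "(real \<Rightarrow> real) \<Rightarrow> 'a measure \<Rightarrow> ('a \<Rightarrow> real) \<Rightarrow> real" where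
  "J f M X = (LBINT u:{0<..<1}. f u * quantile M X u)"

definition prec :: "'a measure \<Rightarrow> ('a \<Rightarrow> real) \<Rightarrow> ('a \<Rightarrow> real) \<Rightarrow> bool" where
  "prec M X Y \<longleftrightarrow> (LINT \<omega>|M. sgn (Y \<omega> - X \<omega>)) > 0"

text \<open>Continuity off a finite set of points, with finite one-sided limits at the
  exceptional points.\<close>

definition piecewise_continuous_on :: "real \<Rightarrow> real \<Rightarrow> (real \<Rightarrow> real) \<Rightarrow> bool" where
  "piecewise_continuous_on a b f \<longleftrightarrow>
     (\<exists>S. finite S \<and> S \<subseteq> {a..b} \<and> continuous_on ({a..b} - S) f \<and>
        (\<forall>t\<in>S. (a < t \<longrightarrow> (\<exists>L. (f \<longlongrightarrow> L) (at_left t))) \<and>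
               (t < b \<longrightarrow> (\<exists>L. (f \<longlongrightarrow> L) (at_right t)))))"

text \<open>The infimum and supremum are taken in \<^typ>\<open>ereal\<close>, so that equating them with real
  numbers \<open>r\<close> and \<open>R\<close> includes their finiteness.\<close>

locale basic_tuple = prob_space M for M :: "'a measure" +
  fixes m :: nat and X :: "nat \<Rightarrow> 'a \<Rightarrow> real" and r R :: real
  assumes m_ge_3: "m \<ge> 3"
    and indep: "indep_vars (\<lambda>_. borel) X {1..m}"
    and chain: "\<forall>i\<in>{1..<m}. prec M (X i) (X (Suc i))"
    and cycle: "prec M (X m) (X 1)"
    and inf_eq: "(INF u1\<in>{0<..<1}. INF u2\<in>{0<..<1}.
        MIN (i1, i2)\<in>{(i1, i2). i1 \<in> {1..m} \<and> i2 \<in> {1..m} \<and> i1 \<noteq> i2}.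
          ereal \<bar>quantile M (X i1) u1 - quantile M (X i2) u2\<bar>) = ereal r"
    and r_pos: "r > 0"
    and sup_eq: "(SUP u1\<in>{0<..<1}. SUP u2\<in>{0<..<1}.
        MAX (i1, i2)\<in>{(i1, i2). i1 \<in> {1..m} \<and> i2 \<in> {1..m} \<and> i1 \<noteq> i2}.
          ereal \<bar>quantile M (X i1) u1 - quantile M (X i2) u2\<bar>) = ereal R"

text \<open>A multi-index \<open>i\<^sub>1 \<dots> i\<^sub>k\<close> is a list of length \<open>k\<close>; its \<open>l\<close>-th letter, counted from 1, is
  \<open>w ! (l - 1)\<close>.\<close>

definition multi_indices :: "nat \<Rightarrow> nat \<Rightarrow> nat list set" where
  "multi_indices m k = {w. length w = k \<and> set w \<subseteq> {1..m}}"

definition combined_quantile ::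
    "'a measure \<Rightarrow> (nat \<Rightarrow> 'a \<Rightarrow> real) \<Rightarrow> real \<Rightarrow> nat list \<Rightarrow> real \<Rightarrow> real" where
  "combined_quantile M X \<epsilon> w u = (\<Sum>l=1..length w. \<epsilon> ^ l * quantile M (X (w ! (l - 1))) u)"

definition generation ::
    "'a measure \<Rightarrow> nat \<Rightarrow> (nat \<Rightarrow> 'a \<Rightarrow> real) \<Rightarrow> real \<Rightarrow> (nat list \<Rightarrow> 'b \<Rightarrow> real) \<Rightarrow> nat
      \<Rightarrow> ('b \<Rightarrow> real) set" where
  "generation M m X \<epsilon> U k =
     (\<lambda>w. \<lambda>\<omega>. combined_quantile M X \<epsilon> w (U w \<omega>)) ` multi_indices m k"

end

theory Submission
  imports Defs
begin

text \<open>A combined quantile function is again nondecreasing and left-continuous on \<open>(0,1)\<close>, and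
  such a function \<open>g\<close> is the quantile function of \<open>g(U)\<close> for uniform \<open>U\<close>. Hence \<open>J\<^sub>f\<close> is linear
  along the generations and the formula is a geometric sum. The finiteness of \<open>R\<close> enters
  through integrability: it makes each basic quantile function bounded.\<close>

section \<open>Quantile functions\<close>

context prob_space
begin

text \<open>Gives access to the known limits of \<open>cdf\<close> at both ends of the line.\<close>

lemma prob_le_eq_cdf:
  fixes X :: "'a \<Rightarrow> real"
  assumes "X \<in> borel_measurable M"
  shows "\<P>(\<omega> in M. X \<omega> \<le> x) = cdf (distr M borel X) x"
  using assms unfolding cdf_def
  by (subst measure_distr) (auto intro!: arg_cong[where f = prob])

text \<open>The distribution function tends to 1 at infinity and so exceeds \<open>u\<close>
  somewhere.\<close>

lemma quantile_set_nonempty: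
  fixes X :: "'a \<Rightarrow> real"
  assumes "X \<in> borel_measurable M" "u < 1"
  shows "{x. u \<le> \<P>(\<omega> in M. X \<omega> \<le> x)} \<noteq> {}"
proof -
  interpret D: real_distribution "distr M borel X"
    using assms by (intro real_distribution_distr) auto
  have "eventually (\<lambda>x. u < cdf (distr M borel X) x) at_top"
    using order_tendstoD(1)[OF D.cdf_lim_at_top_prob assms(2)] .
  then obtain x where "u < cdf (distr M borel X) x"
    using eventually_happens'[OF trivial_limit_at_top_linorder] by blast
  then show ?thesis
    unfolding prob_le_eq_cdf[OF assms(1)] by (auto intro!: exI[of _ x])
qed

lemma prob_le_mono:
  fixes X :: "'a \<Rightarrow> real"
  assumes "X \<in> borel_measurable M" "x \<le> y"
  shows "\<P>(\<omega> in M. X \<omega> \<le> x) \<le> \<P>(\<omega> in M. X \<omega> \<le> y)"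
  using assms by (intro finite_measure_mono) auto

text \<open>The distribution function tends to 0 at minus infinity; by monotonicity, any point where
  it is below \<open>u\<close> bounds the set from below.\<close>

lemma quantile_set_bdd_below:
  fixes X :: "'a \<Rightarrow> real"
  assumes "X \<in> borel_measurable M" "0 < u"
  shows "bdd_below {x. u \<le> \<P>(\<omega> in M. X \<omega> \<le> x)}"
proof -
  interpret D: real_distribution "distr M borel X"
    using assms by (intro real_distribution_distr) auto
  have "eventually (\<lambda>x. cdf (distr M borel X) x < u) at_bot"
    using order_tendstoD(2)[OF D.cdf_lim_at_bot assms(2)] .
  then obtain b where "cdf (distr M borel X) b < u"
    using eventually_happens'[OF trivial_limit_at_bot_linorder] by blast
  then have b: "\<P>(\<omega> in M. X \<omega> \<le> b) < u"
    by (simp add: prob_le_eq_cdf[OF assms(1)])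
  show ?thesis
  proof (rule bdd_belowI)
    fix x assume x: "x \<in> {x. u \<le> \<P>(\<omega> in M. X \<omega> \<le> x)}"
    show "b \<le> x"
    proof (rule ccontr)
      assume "\<not> b \<le> x"
      then show False
        using prob_le_mono[OF assms(1), of x b] x b by simp
    qed
  qed
qed

text \<open>Raising the level shrinks the set whose infimum is taken.\<close>

lemma quantile_mono:
  fixes X :: "'a \<Rightarrow> real"
  assumes "X \<in> borel_measurable M" "0 < u" "u \<le> v" "v < 1"
  shows "quantile M X u \<le> quantile M X v"
  unfolding quantile_def
  by (rule cInf_superset_mono) (use assms quantile_set_nonempty quantile_set_bdd_below in auto)

text \<open>Follows from monotonicity of the distribution function alone. Together with the next
  lemma it translates between levels and values in the proof of left-continuity.\<close>

lemma le_quantile: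
  fixes X :: "'a \<Rightarrow> real"
  assumes "X \<in> borel_measurable M" "u < 1" "\<P>(\<omega> in M. X \<omega> \<le> x) < u"
  shows "x \<le> quantile M X u"
  unfolding quantile_def
proof (rule cInf_greatest[OF quantile_set_nonempty[OF assms(1,2)]])
  fix y assume y: "y \<in> {x. u \<le> \<P>(\<omega> in M. X \<omega> \<le> x)}"
  show "x \<le> y"
  proof (rule ccontr)
    assume "\<not> x \<le> y"
    then show False
      using prob_le_mono[OF assms(1), of y x] y assms(3) by simp
  qed
qed

lemma prob_less_quantile:
  fixes X :: "'a \<Rightarrow> real"
  assumes "X \<in> borel_measurable M" "0 < u" "x < quantile M X u"
  shows "\<P>(\<omega> in M. X \<omega> \<le> x) < u"
proof (rule ccontr)
  assume "\<not> \<P>(\<omega> in M. X \<omega> \<le> x) < u"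
  then have "quantile M X u \<le> x"
    unfolding quantile_def using quantile_set_bdd_below[OF assms(1,2)]
    by (intro cInf_lower) auto
  then show False using assms(3) by simp
qed

lemma tendsto_quantile_at_left:
  fixes X :: "'a \<Rightarrow> real"
  assumes X: "X \<in> borel_measurable M" and u: "0 < u" "u < 1"
  shows "(quantile M X \<longlongrightarrow> quantile M X u) (at_left u)"
proof (rule order_tendstoI)
  fix a assume "a < quantile M X u"
  \<comment> \<open>\<open>le_quantile\<close> yields only the weak bound
    \<open>b \<le> quantile M X v\<close>; the gap between \<open>a\<close> and \<open>b\<close>
    makes it strict.\<close>
  then obtain b where b: "a < b" "b < quantile M X u"
    using dense by blast
  have less: "\<P>(\<omega> in M. X \<omega> \<le> b) < u"
    by (rule prob_less_quantile[OF X u(1) b(2)])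
  have "a < quantile M X v" if "\<P>(\<omega> in M. X \<omega> \<le> b) < v" "v < u" for v
    using le_quantile[OF X _ that(1)] that(2) u b(1) by simp
  then show "eventually (\<lambda>v. a < quantile M X v) (at_left u)"
    using less by (auto simp: eventually_at_left_field)
next
  fix a assume "quantile M X u < a"
  then have "quantile M X v < a" if "0 < v" "v < u" for v
    using quantile_mono[OF X that(1), of u] that u by simp
  then show "eventually (\<lambda>v. quantile M X v < a) (at_left u)"
    using u by (auto simp: eventually_at_left_field)
qed

text \<open>Measurability on the whole line, including the junk values outside \<open>(0,1)\<close>, is needed:
  a uniform variable may leave \<open>(0,1)\<close> on a null set.\<close>

lemma borel_measurable_quantile:
  fixes X :: "'a \<Rightarrow> real"
  assumes X: "X \<in> borel_measurable M"
  shows "quantile M X \<in> borel_measurable borel"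
\<comment> \<open>The function is monotone on the open unit interval and constant on both outer
  rays. The point 1 stands alone, because the set there may or may not be empty.\<close>
proof (rule measurable_piecewise_restrict[where C = "{{..0}, {0<..<1}, {1}, {1<..}}"])
  show "space borel \<subseteq> \<Union> {{..0}, {0<..<1}, {1}, {1<..}::real set}"
    by auto
next
  fix A :: "real set" assume "A \<in> {{..0}, {0<..<1}, {1}, {1<..}}"
  moreover have "quantile M X \<in> borel_measurable (restrict_space borel {0<..<1})"
    by (intro borel_measurable_mono_on_fnc) (auto intro!: mono_onI quantile_mono[OF X])
  moreover have "quantile M X u = Inf UNIV" if "u \<le> 0" for u
    unfolding quantile_def using that
    by (intro arg_cong[where f = Inf]) (auto intro: order_trans)
  then have "quantile M X \<in> borel_measurable (restrict_space borel {..0})"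
    by (subst measurable_cong[where g = "\<lambda>_. Inf UNIV"]) (auto simp: space_restrict_space)
  moreover have "quantile M X u = Inf {}" if "1 < u" for u
    unfolding quantile_def using that
    by (intro arg_cong[where f = Inf]) (auto simp: not_le intro: le_less_trans[OF prob_le_1])
  then have "quantile M X \<in> borel_measurable (restrict_space borel {1<..})"
    by (subst measurable_cong[where g = "\<lambda>_. Inf {}"]) (auto simp: space_restrict_space)
  moreover have "quantile M X \<in> borel_measurable (restrict_space borel {1})"
    by (subst measurable_cong[where g = "\<lambda>_. quantile M X 1"]) (auto simp: space_restrict_space)
  ultimately show "quantile M X \<in> borel_measurable (restrict_space borel A)"
    by auto
qed auto

text \<open>Within the unit interval, \<open>{v. g v \<le> x}\<close> is an initial segment up to
  null sets. By left-continuity at \<open>u\<close>, it has length at least \<open>u\<close> exactly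
  when it contains \<open>u\<close>, so the set defining the quantile is the ray
  \<open>{g u..}\<close>.\<close>

lemma quantile_of_uniform:
  assumes U: "U \<in> borel_measurable M"
    and distr_U: "distr M lborel U = uniform_measure lborel {0..1}"
    and g: "g \<in> borel_measurable borel"
    and mono: "mono_on {0<..<1} g"
    and left_cont: "(g \<longlongrightarrow> g u) (at_left u)"
    and u: "0 < u" "u < 1"
  shows "quantile M (\<lambda>\<omega>. g (U \<omega>)) u = (g u :: real)"
proof -
  have meas: "{v. g v \<le> x} \<in> sets borel" for x
    using g by measurable
  have prob_eq: "\<P>(\<omega> in M. g (U \<omega>) \<le> x) = measure lborel ({0..1} \<inter> {v. g v \<le> x})" for x
  proof -
    have "\<P>(\<omega> in M. g (U \<omega>) \<le> x) = measure (distr M lborel U) {v. g v \<le> x}"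
      using U meas by (subst measure_distr) (auto intro!: arg_cong[where f = prob])
    also have "\<dots> = measure lborel ({0..1} \<inter> {v. g v \<le> x})"
      using meas unfolding distr_U by (subst measure_uniform_measure) auto
    finally show ?thesis .
  qed
  have fin: "{0..1} \<inter> {v. g v \<le> x} \<in> fmeasurable lborel" for x
    using meas by (intro fmeasurable_Int_fmeasurable fmeasurableI) auto
  have "u \<le> \<P>(\<omega> in M. g (U \<omega>) \<le> x) \<longleftrightarrow> g u \<le> x" for x
  proof
    assume "g u \<le> x"
    \<comment> \<open>The point 0 is left out because monotonicity is known only on the open
      interval; the measure is still \<open>u\<close>.\<close>
    then have "{0<..u} \<subseteq> {0..1} \<inter> {v. g v \<le> x}"
      using u by (auto intro: order_trans[OF mono_onD[OF mono, where s = u]])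
    from measure_mono_fmeasurable[OF this _ fin] show "u \<le> \<P>(\<omega> in M. g (U \<omega>) \<le> x)"
      using u by (simp add: prob_eq)
  next
    assume le: "u \<le> \<P>(\<omega> in M. g (U \<omega>) \<le> x)"
    show "g u \<le> x"
    proof (rule ccontr)
      assume "\<not> g u \<le> x"
      then have "eventually (\<lambda>v. x < g v) (at_left u)"
        using order_tendstoD(1)[OF left_cont] by simp
      then obtain b where b: "b < u" "\<And>v. b < v \<Longrightarrow> v < u \<Longrightarrow> x < g v"
        by (auto simp: eventually_at_left_field)
      obtain v where v: "max 0 b < v" "v < u"
        using dense[of "max 0 b" u] b u by auto
      \<comment> \<open>Since \<open>g v\<close> exceeds \<open>x\<close>, monotonicity excludes
        everything between \<open>v\<close> and 1. The value at 1 is uncontrolled, so this null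
        point is added.\<close>
      have "{0..1} \<inter> {v. g v \<le> x} \<subseteq> {0..v} \<union> {1}"
      proof
        fix y assume y: "y \<in> {0..1} \<inter> {v. g v \<le> x}"
        show "y \<in> {0..v} \<union> {1}"
        proof (rule ccontr)
          assume "y \<notin> {0..v} \<union> {1}"
          then have "g v \<le> g y"
            using y v u by (intro mono_onD[OF mono]) auto
          then show False using b(2)[of v] v y by auto
        qed
      qed
      then have "measure lborel ({0..1} \<inter> {v. g v \<le> x}) \<le> measure lborel ({0..v} \<union> {1})"
        using meas v by (intro measure_mono_fmeasurable fmeasurable.Un fmeasurableI) auto
      also have "\<dots> = v"
        using v by (subst measure_Un_null_set) auto
      finally show False using le v by (simp add: prob_eq)
    qed
  qed
  then have "{x. u \<le> \<P>(\<omega> in M. g (U \<omega>) \<le> x)} = {g u..}"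
    by auto
  then show ?thesis
    by (simp add: quantile_def)
qed

end

section \<open>Piecewise continuous functions\<close>

text \<open>One-sided limits make the function locally bounded at every point, and compactness, in
  the form of a bisection argument, makes the bound uniform.\<close>

lemma piecewise_continuous_on_bounded:
  assumes "piecewise_continuous_on a b f"
  obtains B where "\<And>x. x \<in> {a..b} \<Longrightarrow> \<bar>f x\<bar> \<le> B"
proof (cases "a \<le> b")
  case False
  then show ?thesis by (intro that) auto
next
  case True
  obtain S where S: "finite S" "continuous_on ({a..b} - S) f"
    and left: "\<And>t. t \<in> S \<Longrightarrow> a < t \<Longrightarrow> \<exists>L. (f \<longlongrightarrow> L) (at_left t)"
    and right: "\<And>t. t \<in> S \<Longrightarrow> t < b \<Longrightarrow> \<exists>L. (f \<longlongrightarrow> L) (at_right t)"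
    using assms unfolding piecewise_continuous_on_def by blast
  have bounded_lim: "\<exists>B. eventually (\<lambda>x. \<bar>f x\<bar> \<le> B) F" if "(f \<longlongrightarrow> L) F" for L F
  proof -
    have "eventually (\<lambda>x. \<bar>f x\<bar> < \<bar>L\<bar> + 1) F"
      using order_tendstoD(2)[OF tendsto_rabs[OF that], of "\<bar>L\<bar> + 1"] by simp
    then show ?thesis
      by (intro exI[of _ "\<bar>L\<bar> + 1"]) (auto elim: eventually_mono)
  qed
  have local: "\<exists>B. eventually (\<lambda>x. \<bar>f x\<bar> \<le> B) (at t within {a..b})" if t: "t \<in> {a..b}" for t
  proof (cases "t \<in> S")
    case False
    have "(f \<longlongrightarrow> f t) (at t within ({a..b} - S))"
      using S(2) t False by (auto simp: continuous_on)
    \<comment> \<open>A finite set is closed, so its complement is an open neighbourhood of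
      \<open>t\<close>.\<close>
    also have "at t within ({a..b} - S) = at t within {a..b}"
      using False S(1) by (intro at_within_nhd[where S = "- S"]) (auto simp: finite_imp_closed)
    finally show ?thesis by (rule bounded_lim)
  next
    case True
    \<comment> \<open>At \<open>t = a\<close> no left limit is given, but the guard
      \<open>x \<in> {a..b}\<close> makes the claim vacuous there. The right endpoint is treated
      likewise.\<close>
    have "\<exists>B. eventually (\<lambda>x. x \<in> {a..b} \<longrightarrow> \<bar>f x\<bar> \<le> B) (at_left t)"
    proof (cases "a < t")
      case True
      then obtain B where "eventually (\<lambda>x. \<bar>f x\<bar> \<le> B) (at_left t)"
        using left[OF \<open>t \<in> S\<close>] bounded_lim by blast
      then show ?thesis by (auto elim: eventually_mono)
    next
      case False
      then show ?thesis
        using t by (auto simp: eventually_at_filter intro!: always_eventually)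
    qed
    moreover have "\<exists>B. eventually (\<lambda>x. x \<in> {a..b} \<longrightarrow> \<bar>f x\<bar> \<le> B) (at_right t)"
    proof (cases "t < b")
      case True
      then obtain B where "eventually (\<lambda>x. \<bar>f x\<bar> \<le> B) (at_right t)"
        using right[OF \<open>t \<in> S\<close>] bounded_lim by blast
      then show ?thesis by (auto elim: eventually_mono)
    next
      case False
      then show ?thesis
        using t by (auto simp: eventually_at_filter intro!: always_eventually)
    qed
    ultimately obtain B C where
      "eventually (\<lambda>x. x \<in> {a..b} \<longrightarrow> \<bar>f x\<bar> \<le> B) (at_left t)"
      "eventually (\<lambda>x. x \<in> {a..b} \<longrightarrow> \<bar>f x\<bar> \<le> C) (at_right t)"
      by blast
    then have "eventually (\<lambda>x. x \<in> {a..b} \<longrightarrow> \<bar>f x\<bar> \<le> max B C) (at t)"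
      by (auto simp: eventually_at_split elim!: eventually_mono)
    then show ?thesis
      by (auto simp: eventually_at_filter elim!: eventually_mono)
  qed
  \<comment> \<open>The repeated membership comes from the bisection predicate: small intervals
    around a point may stick out of \<open>{a..b}\<close>, where nothing is known about
    \<open>f\<close>.\<close>
  have "\<exists>B. \<forall>x\<in>{a..b}. x \<in> {a..b} \<longrightarrow> \<bar>f x\<bar> \<le> B"
  proof (rule Bolzano[OF True, where P = "\<lambda>c d. \<exists>B. \<forall>x\<in>{c..d}. x \<in> {a..b} \<longrightarrow> \<bar>f x\<bar> \<le> B"])
    fix c d e
    assume "\<exists>B. \<forall>x\<in>{c..d}. x \<in> {a..b} \<longrightarrow> \<bar>f x\<bar> \<le> B" "\<exists>B. \<forall>x\<in>{d..e}. x \<in> {a..b} \<longrightarrow> \<bar>f x\<bar> \<le> B"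
    then obtain B C where "\<forall>x\<in>{c..d}. x \<in> {a..b} \<longrightarrow> \<bar>f x\<bar> \<le> B" "\<forall>x\<in>{d..e}. x \<in> {a..b} \<longrightarrow> \<bar>f x\<bar> \<le> C"
      by blast
    then have "\<bar>f x\<bar> \<le> max B C" if "x \<in> {c..e}" "x \<in> {a..b}" for x
      using that by (cases "x \<le> d") (auto simp: le_max_iff_disj)
    then show "\<exists>B. \<forall>x\<in>{c..e}. x \<in> {a..b} \<longrightarrow> \<bar>f x\<bar> \<le> B"
      by blast
  next
    fix t assume "a \<le> t" "t \<le> b"
    then obtain B where "eventually (\<lambda>x. \<bar>f x\<bar> \<le> B) (at t within {a..b})"
      using local by auto
    then obtain d where d: "d > 0"
      "\<And>x. x \<in> {a..b} \<Longrightarrow> x \<noteq> t \<Longrightarrow> dist x t < d \<Longrightarrow> \<bar>f x\<bar> \<le> B"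
      unfolding eventually_at by blast
    \<comment> \<open>The filter at \<open>t\<close> ignores \<open>t\<close> itself, so
      \<open>f t\<close> enters the bound separately.\<close>
    have "\<bar>f x\<bar> \<le> max B \<bar>f t\<bar>" if "p \<le> t" "t \<le> q" "q - p < d" "x \<in> {p..q}" "x \<in> {a..b}" for p q x
      using d(2)[of x] that by (cases "x = t") (auto simp: dist_real_def le_max_iff_disj)
    then show "\<exists>d>0. \<forall>p q. p \<le> t \<and> t \<le> q \<and> q - p < d \<longrightarrow>
        (\<exists>B. \<forall>x\<in>{p..q}. x \<in> {a..b} \<longrightarrow> \<bar>f x\<bar> \<le> B)"
      using d(1) by blast
  qed
  then show ?thesis using that by blast
qed

text \<open>The indicator discards the arbitrary values outside the interval; inside it,
  \<open>f\<close> differs from a measurable function only on the finite exceptional set.\<close>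

lemma piecewise_continuous_on_borel_measurable:
  assumes "piecewise_continuous_on a b f"
  shows "(\<lambda>x. indicator {a..b} x * f x) \<in> borel_measurable borel"
proof -
  obtain S where S: "finite S" "continuous_on ({a..b} - S) f"
    using assms unfolding piecewise_continuous_on_def by blast
  have "(\<lambda>x. indicator ({a..b} - S) x *\<^sub>R f x) \<in> borel_measurable borel"
    using S borel_closed[OF finite_imp_closed[OF S(1)]]
    by (intro borel_measurable_continuous_on_indicator) auto
  then show ?thesis
    by (rule measurable_discrete_difference[where X = S])
      (use S in \<open>auto simp: countable_finite indicator_def\<close>)
qed

text \<open>A bounded measurable function on an interval of finite length is integrable; this later
  justifies exchanging sum and integral.\<close>

lemma set_integrable_piecewise_continuous_mult:
  assumes f: "piecewise_continuous_on a b f"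
    and g: "g \<in> borel_measurable borel"
    and bound: "\<And>u. u \<in> {a<..<b} \<Longrightarrow> \<bar>g u\<bar> \<le> C"
  shows "set_integrable lborel {a<..<b} (\<lambda>u. f u * g u)"
proof -
  obtain B where B: "\<And>x. x \<in> {a..b} \<Longrightarrow> \<bar>f x\<bar> \<le> B"
    using piecewise_continuous_on_bounded[OF f] by blast
  have meas: "set_borel_measurable lborel {a<..<b} (\<lambda>u. f u * g u)"
  proof -
    \<comment> \<open>The inner indicator equals 1 wherever the outer one does; it is inserted to
      match the measurability lemma for \<open>f\<close>.\<close>
    have "(\<lambda>u. indicator {a<..<b} u * ((indicator {a..b} u * f u) * g u)) \<in> borel_measurable borel"
      using g by (intro borel_measurable_times piecewise_continuous_on_borel_measurable[OF f]) auto
    also have "(\<lambda>u. indicator {a<..<b} u * ((indicator {a..b} u * f u) * g u))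
      = (\<lambda>u. indicator {a<..<b} u *\<^sub>R (f u * g u))"
      by (auto simp: fun_eq_iff indicator_def)
    finally show ?thesis
      by (simp add: set_borel_measurable_def)
  qed
  have "set_integrable lborel {a<..<b} (\<lambda>_. B * C)"
    unfolding set_integrable_def
    by (intro integrable_scaleR_left integrable_real_indicator emeasure_bounded_finite) auto
  then show ?thesis
  proof (rule set_integrable_bound[OF _ meas])
    have "\<bar>f u * g u\<bar> \<le> \<bar>B * C\<bar>" if "u \<in> {a<..<b}" for u
    proof -
      have "\<bar>f u\<bar> * \<bar>g u\<bar> \<le> B * C"
        using that bound[OF that] B[of u] by (intro mult_mono) auto
      then show ?thesis unfolding abs_mult[of "f u"] by linarith
    qed
    then show "AE x in lborel. x \<in> {a<..<b} \<longrightarrow> norm (f x * g x) \<le> norm (B * C)"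
      by auto
  qed
qed

section \<open>Basic tuples\<close>

context basic_tuple
begin

lemma measurable_X: "i \<in> {1..m} \<Longrightarrow> X i \<in> borel_measurable M"
  using indep unfolding indep_vars_def by auto

text \<open>Finiteness is what lets \<open>Min\<close> and \<open>Max\<close> in the tuple
  conditions bound their members.\<close>

lemma finite_distinct_pairs:
  "finite {(i, j). i \<in> {1..m} \<and> j \<in> {1..m} \<and> i \<noteq> j}"
  by (rule finite_subset[of _ "{1..m} \<times> {1..m}"]) auto

lemma quantile_diff_le:
  assumes "i \<in> {1..m}" "j \<in> {1..m}" "i \<noteq> j" "u \<in> {0<..<1}" "v \<in> {0<..<1}"
  shows "\<bar>quantile M (X i) u - quantile M (X j) v\<bar> \<le> R"
proof -
  let ?A = "{(i, j). i \<in> {1..m} \<and> j \<in> {1..m} \<and> i \<noteq> j}"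
  let ?h = "\<lambda>u1 u2 (i1, i2). ereal \<bar>quantile M (X i1) u1 - quantile M (X i2) u2\<bar>"
  have "?h u v (i, j) \<le> Max (?h u v ` ?A)"
    using assms by (intro Max_ge finite_imageI finite_distinct_pairs imageI) auto
  also have "\<dots> \<le> (SUP u2\<in>{0<..<1}. Max (?h u u2 ` ?A))"
    using assms by (intro SUP_upper)
  also have "\<dots> \<le> (SUP u1\<in>{0<..<1}. SUP u2\<in>{0<..<1}. Max (?h u1 u2 ` ?A))"
    using assms by (intro SUP_upper[of u])
  finally show ?thesis unfolding sup_eq by simp
qed

lemma le_quantile_diff:
  assumes "i \<in> {1..m}" "j \<in> {1..m}" "i \<noteq> j" "u \<in> {0<..<1}" "v \<in> {0<..<1}"
  shows "r \<le> \<bar>quantile M (X i) u - quantile M (X j) v\<bar>"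
proof -
  let ?A = "{(i, j). i \<in> {1..m} \<and> j \<in> {1..m} \<and> i \<noteq> j}"
  let ?h = "\<lambda>u1 u2 (i1, i2). ereal \<bar>quantile M (X i1) u1 - quantile M (X i2) u2\<bar>"
  have "(INF u1\<in>{0<..<1}. INF u2\<in>{0<..<1}. Min (?h u1 u2 ` ?A))
      \<le> (INF u2\<in>{0<..<1}. Min (?h u u2 ` ?A))"
    using assms by (intro INF_lower)
  also have "\<dots> \<le> Min (?h u v ` ?A)"
    using assms by (intro INF_lower)
  also have "\<dots> \<le> ?h u v (i, j)"
    using assms by (intro Min_le finite_imageI finite_distinct_pairs imageI) auto
  finally show ?thesis unfolding inf_eq by simp
qed

text \<open>Squeezes one difference of quantiles between \<open>r\<close> and \<open>R\<close>; its
  purpose is to force \<open>lam\<close> above 1.\<close>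

lemma R_pos: "0 < R"
  using le_quantile_diff[of 1 2 "1/2" "1/2"] quantile_diff_le[of 1 2 "1/2" "1/2"] m_ge_3 r_pos
  by auto

text \<open>\<open>R\<close> controls only differences between distinct indices, so the quantile is
  compared with one fixed value, at 1/2, of another variable of the tuple.\<close>

lemma quantile_bounded:
  assumes "i \<in> {1..m}"
  obtains C where "\<And>u. u \<in> {0<..<1} \<Longrightarrow> \<bar>quantile M (X i) u\<bar> \<le> C"
proof -
  obtain j where j: "j \<in> {1..m}" "j \<noteq> i"
    using m_ge_3 by (cases "i = 1") (auto intro: that[of 1] that[of 2])
  have "\<bar>quantile M (X i) u\<bar> \<le> R + \<bar>quantile M (X j) (1/2)\<bar>" if "u \<in> {0<..<1}" for u
    using quantile_diff_le[OF assms j(1) _ that, of "1/2"] j(2) by auto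
  then show ?thesis by (rule that)
qed

end

section \<open>The formula along the generations\<close>

lemma multi_indices_nth:
  assumes "w \<in> multi_indices m k" "l \<in> {1..k}"
  shows "w ! (l - 1) \<in> {1..m}"
proof -
  have "w ! (l - 1) \<in> set w"
    using assms by (intro nth_mem) (auto simp: multi_indices_def)
  then show ?thesis
    using assms by (auto simp: multi_indices_def)
qed

theorem proposition1:
  fixes M :: "'a measure" and N :: "'b measure"
    and X\<^sub>0 :: "nat \<Rightarrow> 'a \<Rightarrow> real" and U :: "nat list \<Rightarrow> 'b \<Rightarrow> real"
    and f :: "real \<Rightarrow> real" and K r R lam \<epsilon> :: real and m k :: nat
  assumes "basic_tuple M m X\<^sub>0 r R"
    and "lam \<ge> 1 + R / r"
    and "\<epsilon> = 1 / lam"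
    and "k \<ge> 1"
    and "prob_space N"
    and "prob_space.indep_vars N (\<lambda>_. borel) U (multi_indices m k)"
    and "\<forall>w\<in>multi_indices m k. distr N lborel (U w) = uniform_measure lborel {0..1}"
    and "piecewise_continuous_on 0 1 f"
    and "\<forall>i\<in>{1..m}. J f M (X\<^sub>0 i) = K"
  shows "\<forall>X\<in>generation M m X\<^sub>0 \<epsilon> U k. J f N X = K * \<epsilon> * ((1 - \<epsilon> ^ k) / (1 - \<epsilon>))"
proof
  interpret basic_tuple M m X\<^sub>0 r R by fact
  interpret N: prob_space N by fact
  fix X assume "X \<in> generation M m X\<^sub>0 \<epsilon> U k"
  then obtain w where w: "w \<in> multi_indices m k"
    and X: "X = (\<lambda>\<omega>. combined_quantile M X\<^sub>0 \<epsilon> w (U w \<omega>))"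
    unfolding generation_def by auto
  have len: "length w = k"
    using w by (simp add: multi_indices_def)
  define q where "q l = quantile M (X\<^sub>0 (w ! (l - 1)))" for l
  define g where "g = combined_quantile M X\<^sub>0 \<epsilon> w"
  have g_eq: "g u = (\<Sum>l=1..k. \<epsilon> ^ l * q l u)" for u
    by (simp add: g_def q_def combined_quantile_def len)
  have letter: "w ! (l - 1) \<in> {1..m}" if "l \<in> {1..k}" for l
    using multi_indices_nth[OF w that] .
  have X0: "X\<^sub>0 (w ! (l - 1)) \<in> borel_measurable M" if "l \<in> {1..k}" for l
    using measurable_X[OF letter[OF that]] .

  \<comment> \<open>Strictness keeps the denominator \<open>1 - \<epsilon>\<close> nonzero; the sign
    of \<epsilon> is needed for monotonicity of the combined quantile.\<close>
  have "1 < lam"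
    using assms(2) divide_pos_pos[OF R_pos r_pos] by linarith
  then have eps: "0 \<le> \<epsilon>" "\<epsilon> \<noteq> 1"
    using assms(3) by auto

  have quantile_X: "quantile N X u = g u" if "u \<in> {0<..<1}" for u
    unfolding X g_def[symmetric]
  proof (rule N.quantile_of_uniform)
    show "U w \<in> borel_measurable N"
      using assms(6) w unfolding N.indep_vars_def by auto
    show "distr N lborel (U w) = uniform_measure lborel {0..1}"
      using assms(7) w by blast
    show "g \<in> borel_measurable borel"
      unfolding g_eq[abs_def] q_def
      by (intro borel_measurable_sum borel_measurable_times borel_measurable_const
          borel_measurable_quantile X0)
    \<comment> \<open>The coefficients \<open>\<epsilon> ^ l\<close> are nonnegative, so
      monotonicity passes from the summands to the sum.\<close>
    show "mono_on {0<..<1} g"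
      unfolding g_eq[abs_def] q_def using eps(1)
      by (intro mono_onI sum_mono mult_left_mono quantile_mono X0) auto
    show "(g \<longlongrightarrow> g u) (at_left u)"
      unfolding g_eq[abs_def] q_def using that
      by (intro tendsto_sum tendsto_mult tendsto_const tendsto_quantile_at_left X0) auto
  qed (use that in auto)

  have integrable: "set_integrable lborel {0<..<1} (\<lambda>u. f u * q l u)" if l: "l \<in> {1..k}" for l
  proof -
    obtain C where "\<And>u. u \<in> {0<..<1} \<Longrightarrow> \<bar>q l u\<bar> \<le> C"
      using quantile_bounded[OF letter[OF l]] unfolding q_def by blast
    then show ?thesis
      unfolding q_def
      by (intro set_integrable_piecewise_continuous_mult[OF assms(8)]
          borel_measurable_quantile X0 l) auto
  qed

  \<comment> \<open>The identity \<open>quantile_X\<close> holds only on the open unit interval,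
    which is exactly the domain of integration.\<close>
  have "J f N X = (LBINT u:{0<..<1}. (\<Sum>l=1..k. \<epsilon> ^ l * (f u * q l u)))"
    unfolding J_def
    by (intro set_lebesgue_integral_cong)
      (auto simp: quantile_X g_eq sum_distrib_left mult_ac)
  also have "\<dots> = (\<Sum>l=1..k. LBINT u:{0<..<1}. \<epsilon> ^ l * (f u * q l u))"
    unfolding set_lebesgue_integral_def scaleR_sum_right
    by (intro Bochner_Integration.integral_sum)
      (intro set_integrable_mult_right[unfolded set_integrable_def]
        integrable[unfolded set_integrable_def])
  also have "\<dots> = (\<Sum>l=1..k. \<epsilon> ^ l * K)"
  proof (intro sum.cong refl)
    fix l assume "l \<in> {1..k}"
    then have "J f M (X\<^sub>0 (w ! (l - 1))) = K"
      using assms(9) letter by blast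
    then show "(LBINT u:{0<..<1}. \<epsilon> ^ l * (f u * q l u)) = \<epsilon> ^ l * K"
      by (simp add: J_def q_def)
  qed
  \<comment> \<open>The sum starts at exponent 1, which yields the extra factor \<epsilon>;
    \<open>k \<ge> 1\<close> selects the nonempty case of \<open>sum_gp\<close>.\<close>
  also have "\<dots> = K * \<epsilon> * ((1 - \<epsilon> ^ k) / (1 - \<epsilon>))"
    using eps(2) assms(4) sum_gp[of \<epsilon> 1 k]
    by (simp add: algebra_simps flip: sum_distrib_left)
  finally show "J f N X = K * \<epsilon> * ((1 - \<epsilon> ^ k) / (1 - \<epsilon>))" .
qed

end
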